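(* Let $S = \langle g_1, \ldots, g_k\rangle$ be a numerical semigroup and let $N = g_1^2 + \cdots + g_k^2$. The function $\ell_2^m(n)$ is a quasipolynomial of degree $2$ on $n \gg 0$ (that is, it is eventually quasipolynomial of degree $2$), with period $N$ and constant leading coefficient $1/N$.
   Context: A numerical semigroup $S$ is an additive submonoid of $\mathbb{Z}_{\ge 0}$ with finite complement. Writing $S = \langle g_1, \ldots, g_k\rangle = \{z_1 g_1 + \cdots + z_k g_k : z_1, \ldots, z_k \in \mathbb{Z}_{\ge 0}\}$ means that $g_1, \ldots, g_k$ are the (distinct) atoms (irreducible elements, i.e. minimal generators) of $S$. For $n \in S$, the set of factorizations of $n$ is $\mathsf{Z}(n) = \{\mathbf{z} \in \mathbb{Z}_{\ge 0}^k : n = z_1 g_1 + \cdots + z_k g_k\}$. For $\mathbf{z} \in \mathbb{Z}^k$, let $\ell_2(\mathbf{z}) = z_1^2 + \cdots + z_k^2$, and for $n \in S$ let $\ell_2^m(n) = \min\{\ell_2(\mathbf{z}) : \mathbf{z} \in \mathsf{Z}(n)\}$ (here the superscript $m$ stands for "minimum" and is not an exponent). A function $f : \mathbb{Z}_{\ge 0} \to \mathbb{R}$ is a quasipolynomial if there exist periodic functions $c_d(n), \ldots, c_0(n)$, with $c_d$ not identically $0$, such that $f(n) = c_d(n) n^d + \cdots + c_1(n) n + c_0(n)$; the degree of $f$ is $d$, its leading coefficient is $c_d$, and its period is the least common multiple of the periods of the $c_i(n)$. A function $f$ is eventually quasipolynomial if there is a quasipolynomial $h$ with $f(n) = h(n)$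 for all but finitely many $n \in \mathbb{Z}_{\ge 0}$; the degree, period and leading coefficient of $f$ are those of $h$. (Note $\ell_2^m(n)$ is defined for all $n \in S$, hence for all but finitely many $n \in \mathbb{Z}_{\ge 0}$.) *)

theory Defs
  imports Complex_Main "HOL-Library.FuncSet"
begin

definition numerical_semigroup :: "nat set \<Rightarrow> bool" where
  "numerical_semigroup S \<longleftrightarrow>
     0 \<in> S \<and> (\<forall>a\<in>S. \<forall>b\<in>S. a + b \<in> S) \<and> finite (- S)"

definition atoms :: "nat set \<Rightarrow> nat set" where
  "atoms S = {a \<in> S. a \<noteq> 0 \<and> \<not> (\<exists>b\<in>S. \<exists>c\<in>S. b \<noteq> 0 \<and> c \<noteq> 0 \<and> a = b + c)}"

definition generated_semigroup :: "nat \<Rightarrow> (nat \<Rightarrow> nat) \<Rightarrow> nat set" where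
  "generated_semigroup k g = {n. \<exists>z :: nat \<Rightarrow> nat. n = (\<Sum>i=1..k. z i * g i)}"

text \<open>A vector in $\mathbb{Z}^k$ is a function on \<open>{1..k}\<close>, extensional outside this set; the
  factorizations of \<open>n\<close> are the vectors with nonnegative entries. The values \<open>g 1, ..., g k\<close> are
  the generators.\<close>

definition factorizations :: "nat \<Rightarrow> (nat \<Rightarrow> nat) \<Rightarrow> nat \<Rightarrow> (nat \<Rightarrow> int) set" where
  "factorizations k g n =
     {z \<in> {1..k} \<rightarrow>\<^sub>E {0..}. int n = (\<Sum>i=1..k. z i * int (g i))}"

definition ell2 :: "nat \<Rightarrow> (nat \<Rightarrow> int) \<Rightarrow> int" where
  "ell2 k z = (\<Sum>i=1..k. (z i)\<^sup>2)"

text \<open>For positive generators the set below is finite, and it is nonempty exactly for the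
  \<open>n\<close> in the semigroup. For the finitely many other \<open>n\<close> the value is unspecified,
  which is harmless as only the values at all but finitely many \<open>n\<close> are ever used.\<close>

definition ell2_min :: "nat \<Rightarrow> (nat \<Rightarrow> nat) \<Rightarrow> nat \<Rightarrow> int" where
  "ell2_min k g n = Min (ell2 k ` factorizations k g n)"

definition is_period :: "nat \<Rightarrow> (nat \<Rightarrow> real) \<Rightarrow> bool" where
  "is_period p c \<longleftrightarrow> p > 0 \<and> (\<forall>n. c (n + p) = c n)"

definition periodic :: "(nat \<Rightarrow> real) \<Rightarrow> bool" where
  "periodic c \<longleftrightarrow> (\<exists>p. is_period p c)"

definition min_period :: "(nat \<Rightarrow> real) \<Rightarrow> nat" where
  "min_period c = (LEAST p. is_period p c)"

text \<open>\<open>h\<close> is the quasipolynomial of degree \<open>d\<close> with coefficient functions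
  \<open>c 0, ..., c d\<close>.\<close>

definition quasipolynomial_with :: "nat \<Rightarrow> (nat \<Rightarrow> nat \<Rightarrow> real) \<Rightarrow> (nat \<Rightarrow> real) \<Rightarrow> bool" where
  "quasipolynomial_with d c h \<longleftrightarrow>
     (\<forall>i\<le>d. periodic (c i)) \<and> (\<exists>n. c d n \<noteq> 0) \<and>
     (\<forall>n. h n = (\<Sum>i\<le>d. c i n * real n ^ i))"

definition quasipolynomial_period :: "nat \<Rightarrow> (nat \<Rightarrow> nat \<Rightarrow> real) \<Rightarrow> nat" where
  "quasipolynomial_period d c = (LCM i\<in>{..d}. min_period (c i))"

text \<open>\<open>f\<close> is eventually quasipolynomial of degree \<open>d\<close>, period \<open>p\<close> and leading coefficient \<open>lc\<close>.
  The quasipolynomial \<open>h\<close>, its degree and its coefficient functions are determined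
  by \<open>f\<close>, so the existential quantifier loses nothing.\<close>

definition eventually_quasipolynomial ::
  "(nat \<Rightarrow> real) \<Rightarrow> nat \<Rightarrow> nat \<Rightarrow> (nat \<Rightarrow> real) \<Rightarrow> bool" where
  "eventually_quasipolynomial f d p lc \<longleftrightarrow>
     (\<exists>h c. quasipolynomial_with d c h \<and> finite {n. f n \<noteq> h n} \<and>
            quasipolynomial_period d c = p \<and> c d = lc)"

end

(* The integer solutions of z . g = n are the translates q g + w of the integer solutions
   of w . g = r, where n = q N + r with 0 <= r < N, and |q g + w|^2 = q^2 N + 2 q r + |w|^2. If w is
   a shortest integer solution for r, then q g + w is nonnegative for large q, so the
   minimum over the factorizations of n is (n^2 - r^2) / N + |w|^2. The constant coefficient
   |w|^2 - r^2 / N is the squared distance from w to (r / N) g. It vanishes at n only if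
   N divides every n g_i, hence only if N divides n, since the g_i generate consecutive
   integers. So every period of the constant coefficient is a multiple of N. *)

theory Submission
  imports Defs
begin

lemma ell2_nonneg: "ell2 k z \<ge> 0"
  unfolding ell2_def by (intro sum_nonneg) auto

lemma ell2_cong: "(\<And>i. i \<in> {1..k} \<Longrightarrow> z i = w i) \<Longrightarrow> ell2 k z = ell2 k w"
  unfolding ell2_def by (intro sum.cong) auto

text \<open>This expands the squared length of \<open>a z + b g\<close>. It serves with
  \<open>a = 1\<close> to translate by a multiple of \<open>g\<close>, and with
  \<open>a = N\<close>, \<open>b = - r\<close> to detect vectors parallel to
  \<open>g\<close>.\<close>

lemma ell2_linear_combination:
  "ell2 k (\<lambda>i. a * z i + b * int (g i)) =
     a\<^sup>2 * ell2 k z + 2 * a * b * (\<Sum>i=1..k. z i * int (g i)) + b\<^sup>2 * int (\<Sum>i=1..k. (g i)\<^sup>2)"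
proof -
  have "ell2 k (\<lambda>i. a * z i + b * int (g i)) =
      (\<Sum>i=1..k. a\<^sup>2 * (z i)\<^sup>2 + 2 * a * b * (z i * int (g i)) + b\<^sup>2 * (int (g i))\<^sup>2)"
    unfolding ell2_def by (intro sum.cong) (auto simp: power2_eq_square algebra_simps)
  then show ?thesis
    by (simp add: ell2_def sum.distrib sum_distrib_left)
qed

lemma weight_translate:
  "(\<Sum>i=1..k. (z i + b * int (g i)) * int (g i)) =
     (\<Sum>i=1..k. z i * int (g i)) + b * int (\<Sum>i=1..k. (g i)\<^sup>2)"
  by (simp add: sum.distrib sum_distrib_left power2_eq_square algebra_simps)

text \<open>A positive generator bounds its coefficient by \<open>n\<close>. Finiteness is what
  makes \<open>Min\<close> in \<open>ell2_min\<close> a genuine minimum.\<close>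

lemma finite_factorizations:
  assumes pos: "\<And>i. i \<in> {1..k} \<Longrightarrow> g i > 0"
  shows "finite (factorizations k g n)"
proof (rule finite_subset)
  show "factorizations k g n \<subseteq> {1..k} \<rightarrow>\<^sub>E {0..int n}"
  proof
    fix z assume z: "z \<in> factorizations k g n"
    then have nonneg: "z i \<ge> 0" if "i \<in> {1..k}" for i
      using that by (auto simp: factorizations_def PiE_def Pi_def)
    have "z i \<le> int n" if i: "i \<in> {1..k}" for i
    proof -
      have "z i * 1 \<le> z i * int (g i)"
        using pos[OF i] nonneg[OF i] by (intro mult_left_mono) auto
      also have "\<dots> \<le> (\<Sum>i=1..k. z i * int (g i))"
        using i nonneg by (intro member_le_sum) auto
      finally show ?thesis
        using z by (simp add: factorizations_def)
    qed
    then show "z \<in> {1..k} \<rightarrow>\<^sub>E {0..int n}"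
      using z nonneg by (auto simp: factorizations_def PiE_def Pi_def)
  qed
qed (auto intro: finite_PiE)

text \<open>Two consecutive elements play the part of coprimality of the generators: they yield an
  integer vector of weight 1, and from divisibility of \<open>r * s\<close> and
  \<open>r * Suc s\<close> they yield that of \<open>r\<close>.\<close>

lemma numerical_semigroup_consecutive:
  assumes "numerical_semigroup S"
  obtains s where "s \<in> S" "Suc s \<in> S"
proof -
  have "finite (- S)"
    using assms by (simp add: numerical_semigroup_def)
  then obtain b where "\<forall>s\<in>- S. s < b"
    by (meson finite_nat_set_iff_bounded)
  then show ?thesis
    using that[of b] by (metis ComplI less_irrefl not_less_eq less_Suc_eq)
qed

text \<open>Negative entries are allowed on purpose: the set of competitors is then carried along by
  translations by multiples of \<open>g\<close>, which fails for factorizations.\<close>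

definition shortest_solution :: "nat \<Rightarrow> (nat \<Rightarrow> nat) \<Rightarrow> int \<Rightarrow> (nat \<Rightarrow> int) \<Rightarrow> bool" where
  "shortest_solution k g r w \<longleftrightarrow> (\<Sum>i=1..k. w i * int (g i)) = r \<and>
     (\<forall>z. (\<Sum>i=1..k. z i * int (g i)) = r \<longrightarrow> ell2 k w \<le> ell2 k z)"

text \<open>Subtracting the coefficients of \<open>s\<close> from those of \<open>Suc s\<close>
  gives a vector of weight 1. Its multiple by \<open>r\<close> is a solution, and squared lengths
  are well-ordered.\<close>

lemma shortest_solution_exists:
  assumes s: "s \<in> generated_semigroup k g" and Suc_s: "Suc s \<in> generated_semigroup k g"
  shows "\<exists>w. shortest_solution k g r w"
proof -
  obtain x y where x: "s = (\<Sum>i=1..k. x i * g i)" and y: "Suc s = (\<Sum>i=1..k. y i * g i)"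
    using s Suc_s by (auto simp: generated_semigroup_def)
  have "(\<Sum>i=1..k. (int (y i) - int (x i)) * int (g i)) = int (Suc s) - int s"
    unfolding y by (subst x) (simp add: sum_subtractf algebra_simps)
  then have "(\<Sum>i=1..k. (r * (int (y i) - int (x i))) * int (g i)) = r"
    by (simp add: mult.assoc flip: sum_distrib_left)
  then obtain w where "(\<Sum>i=1..k. w i * int (g i)) = r"
    "\<forall>z. (\<Sum>i=1..k. z i * int (g i)) = r \<longrightarrow> nat (ell2 k w) \<le> nat (ell2 k z)"
    using ex_has_least_nat[of "\<lambda>w. (\<Sum>i=1..k. w i * int (g i)) = r"
        "\<lambda>i. r * (int (y i) - int (x i))" "\<lambda>w. nat (ell2 k w)"]
    by auto
  then show ?thesis
    unfolding shortest_solution_def using ell2_nonneg by (metis nat_le_iff nat_0_le)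
qed

lemma shortest_solution_zero: "shortest_solution k g 0 w \<Longrightarrow> ell2 k w = 0"
  using ell2_nonneg[of k w]
  by (auto simp: shortest_solution_def ell2_def dest!: spec[of _ "\<lambda>_. 0"])

text \<open>Adding \<open>q g\<close> changes the squared length by an amount that depends only on
  \<open>q\<close> and the weight, so it preserves the order of lengths among vectors of equal
  weight.\<close>

lemma shortest_solution_translate_le:
  fixes q r :: int
  assumes w: "shortest_solution k g r w"
    and z: "(\<Sum>i=1..k. z i * int (g i)) = q * int (\<Sum>i=1..k. (g i)\<^sup>2) + r"
  shows "ell2 k (\<lambda>i. w i + q * int (g i)) \<le> ell2 k z"
proof -
  have v: "(\<Sum>i=1..k. (z i + (- q) * int (g i)) * int (g i)) = r"
    by (simp only: weight_translate z)
  then have "ell2 k w \<le> ell2 k (\<lambda>i. z i + (- q) * int (g i))"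
    using w by (simp only: shortest_solution_def)
  moreover have "ell2 k (\<lambda>i. w i + q * int (g i)) =
      ell2 k w + 2 * q * r + q\<^sup>2 * int (\<Sum>i=1..k. (g i)\<^sup>2)"
    using ell2_linear_combination[of k 1 w q g] w by (simp add: shortest_solution_def)
  moreover have "ell2 k z = ell2 k (\<lambda>i. z i + (- q) * int (g i)) + 2 * q * r + q\<^sup>2 * int (\<Sum>i=1..k. (g i)\<^sup>2)"
    using ell2_linear_combination[of k 1 "\<lambda>i. z i + (- q) * int (g i)" q g] v by simp
  ultimately show ?thesis by linarith
qed

lemma ell2_min_eq:
  fixes q r :: nat
  assumes pos: "\<And>i. i \<in> {1..k} \<Longrightarrow> g i > 0"
    and w: "shortest_solution k g (int r) w"
    and large: "\<And>i. i \<in> {1..k} \<Longrightarrow> \<bar>w i\<bar> \<le> int q"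
  shows "ell2_min k g (q * (\<Sum>i=1..k. (g i)\<^sup>2) + r) =
    (int q)\<^sup>2 * int (\<Sum>i=1..k. (g i)\<^sup>2) + 2 * int q * int r + ell2 k w"
proof -
  let ?N = "\<Sum>i=1..k. (g i)\<^sup>2"
  let ?u = "\<lambda>i. w i + int q * int (g i)"
  \<comment> \<open>Factorizations are extensional, so the translate has to be cut off outside the
    index range.\<close>
  let ?v = "restrict ?u {1..k}"
  have weight_w: "(\<Sum>i=1..k. w i * int (g i)) = int r"
    using w by (simp add: shortest_solution_def)
  have nonneg: "?u i \<ge> 0" if i: "i \<in> {1..k}" for i
  proof -
    have "int q * 1 \<le> int q * int (g i)"
      using pos[OF i] by (intro mult_left_mono) auto
    then show ?thesis using large[OF i] by linarith
  qed
  have "(\<Sum>i=1..k. ?v i * int (g i)) = (\<Sum>i=1..k. ?u i * int (g i))"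
    by (intro sum.cong) auto
  also have "\<dots> = int (q * ?N + r)"
    by (simp only: weight_translate weight_w) simp
  finally have v: "?v \<in> factorizations k g (q * ?N + r)"
    using nonneg unfolding factorizations_def by simp
  have ell2_v: "ell2 k ?v = ell2 k ?u"
    by (rule ell2_cong) auto
  have "ell2_min k g (q * ?N + r) = ell2 k ?u"
    unfolding ell2_min_def
  proof (rule Min_eqI)
    show "finite (ell2 k ` factorizations k g (q * ?N + r))"
      using finite_factorizations[OF pos] by simp
    show "ell2 k ?u \<in> ell2 k ` factorizations k g (q * ?N + r)"
      unfolding ell2_v[symmetric] by (rule imageI[OF v])
    fix y assume "y \<in> ell2 k ` factorizations k g (q * ?N + r)"
    then show "ell2 k ?u \<le> y"
      using shortest_solution_translate_le[OF w] by (auto simp: factorizations_def)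
  qed
  then show ?thesis
    using ell2_linear_combination[of k 1 w "int q" g] weight_w by simp
qed

text \<open>This is the equality case of Cauchy-Schwarz: the squared length of
  \<open>N w - r g\<close> is \<open>N (N |w|^2 - r^2) = 0\<close>. Hence \<open>N\<close> divides
  every \<open>r * g i\<close>, and so \<open>r\<close> times any combination of the
  generators.\<close>

lemma shortest_solution_parallel:
  assumes weight: "(\<Sum>i=1..k. w i * int (g i)) = int r"
    and N: "N = (\<Sum>i=1..k. (g i)\<^sup>2)"
    and len: "int N * ell2 k w = (int r)\<^sup>2"
    and s: "s \<in> generated_semigroup k g"
  shows "N dvd r * s"
proof -
  have "ell2 k (\<lambda>i. int N * w i + (- int r) * int (g i)) =
      int N * (int N * ell2 k w) - 2 * int N * int r * int r + (int r)\<^sup>2 * int N"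
    by (simp only: ell2_linear_combination weight flip: N) (simp add: power2_eq_square)
  also have "\<dots> = 0"
    by (simp only: len) (simp add: power2_eq_square)
  finally have "int N * w i = int r * int (g i)" if "i \<in> {1..k}" for i
    using that by (simp add: ell2_def sum_nonneg_eq_0_iff)
  then have "int N dvd int r * int (g i)" if "i \<in> {1..k}" for i
    using that by (metis dvd_triv_left)
  then have "N dvd r * g i" if "i \<in> {1..k}" for i
    using that by (metis int_dvd_int_iff of_nat_mult)
  moreover obtain z where "s = (\<Sum>i=1..k. z i * g i)"
    using s by (auto simp: generated_semigroup_def)
  moreover have "r * (\<Sum>i=1..k. z i * g i) = (\<Sum>i=1..k. z i * (r * g i))"
    by (simp add: sum_distrib_left mult.left_commute)
  ultimately show ?thesis
    by (simp only: dvd_sum dvd_mult)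
qed

lemma min_period_const: "min_period (\<lambda>_. a) = 1"
  unfolding min_period_def is_period_def by (rule Least_equality) auto

theorem theorem2p10:
  fixes S :: "nat set" and k :: nat and g :: "nat \<Rightarrow> nat" and N :: nat
  assumes "numerical_semigroup S"
    and "S = generated_semigroup k g"
    and "bij_betw g {1..k} (atoms S)"
    and "N = (\<Sum>i=1..k. (g i)\<^sup>2)"
  shows "eventually_quasipolynomial (\<lambda>n. real_of_int (ell2_min k g n)) 2 N (\<lambda>n. 1 / real N)"
proof -
  have pos: "g i > 0" if "i \<in> {1..k}" for i
    using bij_betwE[OF assms(3)] that by (auto simp: atoms_def)
  obtain s where s: "s \<in> generated_semigroup k g" "Suc s \<in> generated_semigroup k g"
    using numerical_semigroup_consecutive[OF assms(1)] assms(2) by blast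
  \<comment> \<open>Without generators only 0 would be generated, but \<open>Suc s\<close>
    is.\<close>
  have "k \<noteq> 0"
    using s(2) by (intro notI) (auto simp: generated_semigroup_def)
  then have "(g 1)\<^sup>2 \<le> N" "g 1 > 0"
    unfolding assms(4) using pos by (auto intro!: member_le_sum)
  then have N: "N > 0"
    by (metis less_le_trans zero_less_power)
  obtain W where W: "\<And>r. shortest_solution k g r (W r)"
    using shortest_solution_exists[OF s] by metis
  \<comment> \<open>For \<open>n = q N + r\<close> one has
    \<open>q^2 N + 2 q r = (n^2 - r^2) / N\<close>; what remains of the minimum besides
    \<open>n^2 / N\<close> depends only on \<open>r\<close>.\<close>
  define c\<^sub>0 where "c\<^sub>0 n = real_of_int (ell2 k (W (int (n mod N)))) - (real (n mod N))\<^sup>2 / real N" for n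
  have period_N: "is_period N c\<^sub>0"
    using N by (simp add: is_period_def c\<^sub>0_def)
  have "N dvd p" if p: "is_period p c\<^sub>0" for p
  proof -
    define r where "r = p mod N"
    \<comment> \<open>A period carries the zero of \<open>c\<^sub>0\<close> at 0, where the zero
      vector is shortest, to \<open>p\<close>.\<close>
    have "c\<^sub>0 p = c\<^sub>0 0"
      using p unfolding is_period_def by (metis add_0)
    also have "\<dots> = 0"
      using shortest_solution_zero[OF W] by (simp add: c\<^sub>0_def)
    finally have "real_of_int (int N * ell2 k (W (int r))) = real_of_int ((int r)\<^sup>2)"
      using N by (simp add: c\<^sub>0_def r_def field_simps)
    then have "int N * ell2 k (W (int r)) = (int r)\<^sup>2"
      by (simp only: of_int_eq_iff)
    then have "N dvd r * s" "N dvd r * Suc s"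
      using shortest_solution_parallel[where w = "W (int r)" and N = N] W[of "int r"] s assms(4)
      by (auto simp only: shortest_solution_def)
    \<comment> \<open>The two multiples of \<open>N\<close> differ by \<open>r\<close>.\<close>
    then have "N dvd r"
      by (simp add: dvd_add_left_iff)
    then show ?thesis
      by (simp add: r_def dvd_mod_iff)
  qed
  then have min_period_c\<^sub>0: "min_period c\<^sub>0 = N"
    unfolding min_period_def using period_N
    by (intro Least_equality) (auto simp: is_period_def intro: dvd_imp_le)
  define c where "c i = (if i = 0 then c\<^sub>0 else if i = 1 then (\<lambda>_. 0) else (\<lambda>_. 1 / real N))" for i :: nat
  define h where "h n = (\<Sum>i\<le>2. c i n * real n ^ i)" for n
  have h: "h n = c\<^sub>0 n + (real n)\<^sup>2 / real N" for n
    by (simp add: h_def c_def numeral_2_eq_2)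
  have "periodic (\<lambda>_. a)" for a
    unfolding periodic_def is_period_def by (intro exI[of _ 1]) simp
  then have "quasipolynomial_with 2 c h"
    using period_N N by (auto simp: quasipolynomial_with_def h_def c_def periodic_def)
  moreover have "quasipolynomial_period 2 c = N"
  proof -
    \<comment> \<open>The two constant coefficients have minimal period 1, so the least common
      multiple is the period of \<open>c\<^sub>0\<close>.\<close>
    have "{..2::nat} = {0, 1, 2}" by auto
    then show ?thesis
      by (simp add: quasipolynomial_period_def c_def min_period_c\<^sub>0 min_period_const)
  qed
  moreover have "c 2 = (\<lambda>n. 1 / real N)"
    by (simp add: c_def)
  moreover have "finite {n. real_of_int (ell2_min k g n) \<noteq> h n}"
  proof -
    let ?T = "{..<N} \<times> {1..k}"
    \<comment> \<open>The sum is a crude bound for all entries of all \<open>N\<close> chosen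
      vectors at once; \<open>n \<ge> B * N\<close> then forces the quotient \<open>q\<close> to be
      at least \<open>B\<close>.\<close>
    define B where "B = (\<Sum>(r, i)\<in>?T. nat \<bar>W (int r) i\<bar>)"
    have B: "\<bar>W (int r) i\<bar> \<le> int B" if "r < N" "i \<in> {1..k}" for r i
    proof -
      have "nat \<bar>W (int r) i\<bar> \<le> B"
        unfolding B_def
        using member_le_sum[of "(r, i)" ?T "\<lambda>(r, i). nat \<bar>W (int r) i\<bar>"] that by auto
      then show ?thesis by linarith
    qed
    have "real_of_int (ell2_min k g n) = h n" if n: "B * N \<le> n" for n
    proof -
      define q r where "q = n div N" and "r = n mod N"
      have r: "r < N" and n_eq: "n = q * N + r"
        using N by (simp_all add: q_def r_def)
      have "B \<le> q"
        using n N by (simp add: q_def less_eq_div_iff_mult_less_eq)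
      then have "\<bar>W (int r) i\<bar> \<le> int q" if "i \<in> {1..k}" for i
        using B[OF r that] by linarith
      then have "ell2_min k g n = (int q)\<^sup>2 * int N + 2 * int q * int r + ell2 k (W (int r))"
        using ell2_min_eq[OF pos W, of r q] unfolding n_eq assms(4) by blast
      then have "real_of_int (ell2_min k g n) =
          (real q)\<^sup>2 * real N + 2 * real q * real r + real_of_int (ell2 k (W (int r)))"
        by simp
      also have "\<dots> = h n"
        unfolding h c\<^sub>0_def r_def[symmetric] n_eq using N
        by (simp add: field_simps power2_eq_square r)
      finally show ?thesis .
    qed
    then have "{n. real_of_int (ell2_min k g n) \<noteq> h n} \<subseteq> {..<B * N}"
      by (auto simp: not_less[symmetric])
    then show ?thesis
      by (rule finite_subset) simp
  qed
  ultimately show ?thesis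
    unfolding eventually_quasipolynomial_def by blast
qed

end
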